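(* For every integer $n\geq 3$, there exists a compact set $A\subset\mathbb{R}^n$ such that for all integers $k$ with $1\leq k\leq n-1$, we have $$d\left(A(k)\right)=d(A)>0.$$
   Context: For sets $A,B\subset\mathbb{R}^n$, the Minkowski sum is $A+B:=\{a+b:a\in A,\,b\in B\}$. For a positive integer $k$, the iterated Minkowski average is $A(k):=\frac1k(\underbrace{A+\dots+A}_{k\text{ times}})=\left\{\frac{a_1+\dots+a_k}{k}: a_1,\dots,a_k\in A\right\}$. The convex hull of $A$ is denoted $\operatorname{co}(A)$. For a nonempty compact set $A\subset\mathbb{R}^n$, $d(A)$ denotes the Hausdorff distance between $A$ and its convex hull with respect to the Euclidean norm: $$d(A):=\sup_{x\in\operatorname{co}(A)}\inf_{y\in A}\|x-y\|_2.$$ *)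

theory Defs
  imports "HOL-Analysis.Analysis"
begin

(* The sum is the k-fold Minkowski sum: addition of sets is elementwise (HOL-Library.Set_Algebras). *)
definition minkowski_average :: "nat \<Rightarrow> 'a::real_vector set \<Rightarrow> 'a set" where
  "minkowski_average k A = (\<lambda>x. (1 / real k) *\<^sub>R x) ` (\<Sum>i\<in>{1..k}. A)"

lemma minkowski_average_alt:
  "minkowski_average k A =
     {(1 / real k) *\<^sub>R (\<Sum>i\<in>{1..k}. a i) | a. \<forall>i\<in>{1..k}. a i \<in> A}"
  unfolding minkowski_average_def by (subst set_sum_alt) auto

(* Meaningful only for nonempty bounded A: otherwise the real-valued SUP and INF may range over
   empty or unbounded sets. On real ^ 'n, norm is the Euclidean norm. *)
definition hull_distance :: "'a::real_normed_vector set \<Rightarrow> real" where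
  "hull_distance A = (SUP x\<in>convex hull A. INF y\<in>A. norm (x - y))"

end

theory Submission
  imports Defs
begin

text \<open>
  Since \<open>A\<close> is contained in \<open>A(k)\<close> and both have the same convex hull, \<open>d(A(k)) \<le> d(A)\<close> always
  holds. Equality with value \<open>r\<close> therefore follows as soon as every point of the hull is within
  \<open>r\<close> of \<open>A\<close> while one point \<open>p\<close> of the hull stays at distance at least \<open>r\<close> from every \<open>A(k)\<close>
  (\<open>hull_distance_minkowski_average_eqI\<close>).

  Such a set is obtained from a simplex of dimension \<open>n - 1\<close>: take the set \<open>E\<close> of its \<open>n\<close>
  vertices, here the standard basis, together with a copy of the full simplex \<open>T\<close> lifted by a
  short vector \<open>u\<close> normal to it. The hull is the prism between \<open>T\<close> and its lifted copy, so moving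
  in the direction \<open>u\<close> reaches the lifted copy within \<open>r = norm u\<close>
  (\<open>convex_hull_near_lifted_hull\<close>).

  Let \<open>p\<close> be the barycentre of \<open>T\<close>. An average of \<open>k\<close> lifted points is lifted, hence at distance
  at least \<open>norm u\<close> from \<open>p\<close>. An average of \<open>k \<le> n - 1\<close> points one of which is the vertex \<open>e i\<close>
  has \<open>i\<close>-th coordinate at least \<open>1 / k \<ge> 1 / (n - 1)\<close>, whereas the coordinates of \<open>p\<close> are
  \<open>1 / n\<close>. This gap does not depend on \<open>u\<close>, so it exceeds \<open>norm u\<close> when \<open>u\<close> is short
  (\<open>barycentre_far_from_averages\<close>).
\<close>

lemma hull_distance_eqI:
  fixes A :: "'a::real_normed_vector set"
  assumes p: "p \<in> convex hull A"
    and near: "\<And>x. x \<in> convex hull A \<Longrightarrow> \<exists>a\<in>A. norm (x - a) \<le> r"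
    and far: "\<And>a. a \<in> A \<Longrightarrow> r \<le> norm (p - a)"
  shows "hull_distance A = r"
proof -
  have bdd: "bdd_below ((\<lambda>y. norm (x - y)) ` A)" for x
    by (rule bdd_belowI[of _ 0]) auto
  have upper: "(INF y\<in>A. norm (x - y)) \<le> r" if "x \<in> convex hull A" for x
    using near[OF that] cINF_lower[OF bdd[of x]] by (meson order_trans)
  have "A \<noteq> {}" using p by auto
  then have "r \<le> (INF y\<in>A. norm (p - y))"
    using far by (intro cINF_greatest) auto
  also have "\<dots> \<le> hull_distance A"
    unfolding hull_distance_def using p upper
    by (intro cSUP_upper bdd_aboveI[of _ r]) auto
  finally have "r \<le> hull_distance A" .
  moreover have "hull_distance A \<le> r"
    unfolding hull_distance_def using p upper by (intro cSUP_least) auto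
  ultimately show ?thesis by simp
qed

lemma subset_minkowski_average:
  assumes "1 \<le> k"
  shows "A \<subseteq> minkowski_average k A"
proof
  fix a assume "a \<in> A"
  have "a = (1 / real k) *\<^sub>R (\<Sum>i\<in>{1..k}. a)"
    using assms by (simp add: sum_constant_scaleR del: sum_constant)
  with \<open>a \<in> A\<close> show "a \<in> minkowski_average k A"
    unfolding minkowski_average_alt by (auto intro!: exI[of _ "\<lambda>_. a"])
qed

lemma mean_in_convex:
  assumes "convex C" and "1 \<le> k" and "\<And>i. i \<in> {1..k} \<Longrightarrow> a i \<in> C"
  shows "(1 / real k) *\<^sub>R (\<Sum>i\<in>{1..k}. a i) \<in> C"
  unfolding scaleR_sum_right using assms by (intro convex_sum) auto

lemma minkowski_average_subset_convex_hull:
  assumes "1 \<le> k"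
  shows "minkowski_average k A \<subseteq> convex hull A"
proof
  fix q assume "q \<in> minkowski_average k A"
  then obtain a where "\<forall>i\<in>{1..k}. a i \<in> A" and "q = (1 / real k) *\<^sub>R (\<Sum>i\<in>{1..k}. a i)"
    unfolding minkowski_average_alt by blast
  with assms show "q \<in> convex hull A"
    using mean_in_convex[OF convex_convex_hull, of k a A] by (simp add: hull_inc)
qed

text \<open>
  The hypothesis \<open>near\<close> concerns \<open>A\<close> and \<open>far\<close> concerns the larger set \<open>A(k)\<close>; because the two hulls
  coincide, each passes to the other set.
\<close>

lemma hull_distance_minkowski_average_eqI:
  fixes A :: "'a::real_normed_vector set"
  assumes k: "1 \<le> k"
    and p: "p \<in> convex hull A"
    and near: "\<And>x. x \<in> convex hull A \<Longrightarrow> \<exists>a\<in>A. norm (x - a) \<le> r"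
    and far: "\<And>q. q \<in> minkowski_average k A \<Longrightarrow> r \<le> norm (p - q)"
  shows "hull_distance (minkowski_average k A) = r" and "hull_distance A = r"
proof -
  note sub = subset_minkowski_average[OF k, of A]
  have hull_eq: "convex hull (minkowski_average k A) = convex hull A"
    using sub minkowski_average_subset_convex_hull[OF k, of A]
    by (metis convex_convex_hull hull_mono hull_minimal subset_antisym)
  show "hull_distance (minkowski_average k A) = r"
    using p near far sub unfolding hull_eq[symmetric]
    by (intro hull_distance_eqI) blast+
  show "hull_distance A = r"
    using p near far sub by (intro hull_distance_eqI) blast+
qed

text \<open>
  The prism \<open>{y + t u. y \<in> T, 0 \<le> t \<le> 1}\<close> over \<open>T = convex hull E\<close> is convex and contains the set,
  so the hull lies in it; \<open>y + t u\<close> is at distance \<open>(1 - t) norm u\<close> from the lifted point \<open>y + u\<close>.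
\<close>

lemma convex_hull_near_lifted_hull:
  fixes E :: "'a::real_normed_vector set"
  assumes "x \<in> convex hull (E \<union> (+) u ` (convex hull E))"
  shows "\<exists>a\<in>E \<union> (+) u ` (convex hull E). norm (x - a) \<le> norm u"
proof -
  define prism where "prism = convex hull E + closed_segment 0 u"
  have "convex prism"
    unfolding prism_def by (intro convex_set_plus) auto
  moreover have "E \<subseteq> prism"
  proof
    fix e assume "e \<in> E"
    then have "e + 0 \<in> prism"
      unfolding prism_def by (intro set_plus_intro hull_inc) auto
    then show "e \<in> prism" by simp
  qed
  moreover have "(+) u ` (convex hull E) \<subseteq> prism"
    unfolding prism_def by (auto simp: add.commute[of u])
  ultimately have "convex hull (E \<union> (+) u ` (convex hull E)) \<subseteq> prism"
    by (intro hull_minimal) auto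
  with assms obtain y t where y: "y \<in> convex hull E" and t: "0 \<le> t" "t \<le> 1"
    and x: "x = y + t *\<^sub>R u"
    unfolding prism_def by (force elim!: set_plus_elim simp: in_segment)
  have "x - (u + y) = (t - 1) *\<^sub>R u"
    by (simp add: x scaleR_left_diff_distrib)
  then have "norm (x - (u + y)) = \<bar>t - 1\<bar> * norm u" by simp
  also have "\<dots> \<le> norm u"
    using t by (intro mult_left_le_one_le) auto
  finally show ?thesis using y by auto
qed

abbreviation unit_vectors :: "(real ^ 'n::finite) set" where
  "unit_vectors \<equiv> range (\<lambda>i. axis i 1)"

lemma standard_simplex_nonneg:
  fixes x :: "real ^ 'n::finite"
  assumes "x \<in> convex hull unit_vectors"
  shows "0 \<le> x $ i"
proof -
  have "convex hull unit_vectors \<subseteq> {x :: real ^ 'n. 0 \<le> x $ i}"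
  proof (rule hull_minimal)
    show "convex {x :: real ^ 'n. 0 \<le> x $ i}"
      by (auto simp: convex_def)
  qed (auto simp: axis_def)
  with assms show ?thesis by auto
qed

lemma inner_vec_standard_simplex:
  fixes x :: "real ^ 'n::finite"
  assumes "x \<in> convex hull unit_vectors"
  shows "vec c \<bullet> x = c"
proof -
  have "convex hull unit_vectors \<subseteq> {x :: real ^ 'n. vec c \<bullet> x = c}"
    by (intro hull_minimal convex_hyperplane) (auto simp: inner_axis)
  with assms show ?thesis by auto
qed

lemma barycentre_in_standard_simplex:
  "vec (1 / real CARD('n)) \<in> convex hull (unit_vectors :: (real ^ 'n::finite) set)"
proof -
  have "(\<Sum>i\<in>UNIV. (1 / real CARD('n)) *\<^sub>R axis i (1::real)) \<in>
      convex hull (unit_vectors :: (real ^ 'n) set)"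
    by (intro convex_sum) (auto intro: hull_inc)
  also have "(\<Sum>i\<in>UNIV. (1 / real CARD('n)) *\<^sub>R axis i (1::real)) =
      (vec (1 / real CARD('n)) :: real ^ 'n)"
    by (simp add: vec_eq_iff axis_def if_distrib cong: if_cong)
  finally show ?thesis .
qed

text \<open>
  If every averaged point is lifted, the normal component of the average is that of \<open>u\<close>. Otherwise
  a vertex \<open>e i\<close> occurs, and because no coordinate of any averaged point is negative, its
  contribution \<open>1 / k\<close> to the \<open>i\<close>-th coordinate cannot be cancelled; this coordinate
  differs from \<open>1 / n\<close> because \<open>k < n\<close>.
\<close>

lemma barycentre_far_from_averages:
  fixes u :: "real ^ 'n::finite"
  assumes u: "u = vec c" and c: "0 \<le> c"
    and short: "norm u \<le> 1 / (real CARD('n))\<^sup>2"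
    and k: "1 \<le> k" "k < CARD('n)"
    and q: "q \<in> minkowski_average k (unit_vectors \<union> (+) u ` (convex hull unit_vectors))"
  shows "norm u \<le> norm (vec (1 / real CARD('n)) - q)"
proof -
  let ?n = "real CARD('n)" and ?T = "convex hull unit_vectors :: (real ^ 'n) set"
  let ?p = "vec (1 / ?n) :: real ^ 'n"
  from q obtain a where a: "\<And>i. i \<in> {1..k} \<Longrightarrow> a i \<in> unit_vectors \<union> (+) u ` ?T"
    and q_eq: "q = (1 / real k) *\<^sub>R (\<Sum>i\<in>{1..k}. a i)"
    unfolding minkowski_average_alt by blast
  show ?thesis
  proof (cases "\<forall>i\<in>{1..k}. a i \<in> (+) u ` ?T")
    case True
    then have "q \<in> (+) u ` ?T"
      unfolding q_eq using k by (intro mean_in_convex convex_translation) auto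
    then obtain y where "y \<in> ?T" and "q = u + y" by auto
    then have "u \<bullet> (q - ?p) = u \<bullet> u"
      using inner_vec_standard_simplex[OF barycentre_in_standard_simplex[where 'n = 'n], of c]
      by (simp add: u inner_simps inner_vec_standard_simplex)
    then have "norm u * norm u \<le> norm u * norm (q - ?p)"
      using norm_cauchy_schwarz[of u "q - ?p"]
      by (simp add: dot_square_norm power2_eq_square)
    then show ?thesis
      by (cases "u = 0") (auto simp: norm_minus_commute)
  next
    case False
    then obtain m i where m: "m \<in> {1..k}" and am: "a m = axis i 1"
      using a by blast
    have nonneg: "0 \<le> a l $ i" if "l \<in> {1..k}" for l
      using a[OF that] c by (auto simp: u axis_def standard_simplex_nonneg)
    have "1 \<le> (\<Sum>l\<in>{1..k}. a l $ i)"
      using member_le_sum[OF m, of "\<lambda>l. a l $ i"] nonneg am by auto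
    then have qi: "1 / real k \<le> q $ i"
      using k by (simp add: q_eq divide_right_mono)
    have "norm u \<le> 1 / ?n\<^sup>2" by (rule short)
    \<comment> \<open>The difference is smallest at \<open>k = n - 1\<close>, where it equals \<open>1 / (n (n - 1))\<close>.\<close>
    also have "\<dots> \<le> 1 / real k - 1 / ?n"
    proof -
      have "real k * (?n + 1) \<le> (?n - 1) * (?n + 1)"
        using k by (intro mult_right_mono) auto
      also have "\<dots> \<le> ?n * ?n" by (simp add: algebra_simps)
      finally show ?thesis
        using k by (simp add: field_simps power2_eq_square)
    qed
    also have "\<dots> \<le> \<bar>(?p - q) $ i\<bar>" using qi by simp
    also have "\<dots> \<le> norm (?p - q)" by (rule component_le_norm_cart)
    finally show ?thesis .
  qed
qed

theorem theorem1p3: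
  assumes "CARD('n::finite) \<ge> 3"
  shows "\<exists>A :: (real ^ 'n) set. compact A \<and> A \<noteq> {} \<and>
    (\<forall>k::nat. 1 \<le> k \<and> k \<le> CARD('n) - 1 \<longrightarrow>
      hull_distance (minkowski_average k A) = hull_distance A \<and> hull_distance A > 0)"
proof -
  let ?n = "real CARD('n)"
  \<comment> \<open>The sum of the \<open>n\<close> coordinates of \<open>u\<close>, which bounds its norm, is then \<open>1 / n\<^sup>2\<close>.\<close>
  define c where "c = 1 / ?n ^ 3"
  define u :: "real ^ 'n" where "u = vec c"
  define A where "A = unit_vectors \<union> (+) u ` (convex hull unit_vectors)"
  have "c > 0" using assms by (simp add: c_def)
  then have "u \<noteq> 0" by (simp add: u_def vec_eq_iff)
  have "norm u \<le> (\<Sum>i\<in>UNIV. \<bar>u $ i\<bar>)" by (rule norm_le_l1_cart)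
  also have "\<dots> = 1 / ?n\<^sup>2"
    using assms by (simp add: u_def c_def power2_eq_square power3_eq_cube)
  finally have short: "norm u \<le> 1 / ?n\<^sup>2" .
  have "compact A"
    unfolding A_def
    by (intro compact_Un compact_translation finite_imp_compact finite_imp_compact_convex_hull) auto
  moreover have "A \<noteq> {}" by (simp add: A_def)
  moreover have "hull_distance (minkowski_average k A) = norm u \<and> hull_distance A = norm u"
    if "1 \<le> k" "k \<le> CARD('n) - 1" for k
  proof -
    have "vec (1 / ?n) \<in> convex hull A"
      using barycentre_in_standard_simplex hull_mono[of unit_vectors A] by (auto simp: A_def)
    moreover have "norm u \<le> norm (vec (1 / ?n) - q)" if "q \<in> minkowski_average k A" for q
      using barycentre_far_from_averages[OF u_def _ short \<open>1 \<le> k\<close>] that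
        \<open>k \<le> CARD('n) - 1\<close> \<open>c > 0\<close> assms by (simp add: A_def)
    ultimately show ?thesis
      using hull_distance_minkowski_average_eqI[OF \<open>1 \<le> k\<close>]
        convex_hull_near_lifted_hull[of _ unit_vectors u, folded A_def] by blast
  qed
  ultimately show ?thesis
    using \<open>u \<noteq> 0\<close> by (intro exI[of _ A]) auto
qed

end
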